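(* Let $\Sigma$ be a signed graph such that $\Sigma{:}E^-$ is bipartite with connected components $C_1,\dots,C_m$, and for each $i$ let $\{V_{i1},V_{i2}\}$ be the unique stable bipartition of $C_i$. Let $\tau$ be the transposition of $\{1,2\}$. Let $w_1<w_2<\dots<w_l$ be the distinct finite values in $\{d^+(V_{i\alpha},V_{j\beta}) : i,j\in[m],\ \alpha,\beta\in[2],\ (i,\alpha)\ne(j,\beta)\}$. For $k\in[l]$ let $E_k'=\{(V_{i\alpha},V_{j\beta}) : (i,\alpha)\neq (j,\beta),\ d^+(V_{i\alpha},V_{j\beta})\le w_k\}$, $E_k''=\{(V_{i\tau(\alpha)},V_{j\tau(\beta)}) : (i,\alpha)\neq (j,\beta),\ d^+(V_{i\alpha},V_{j\beta})\le w_k\}$, $E_k=E_k'\cup E_k''$, and let $\Phi_k$ be the signed graph with vertex set $\{V_{i\alpha}: i\in[m],\alpha\in[2]\}$ (each $V_{i\alpha}$ treated as a single vertex), negative edge set $\{(V_{i1},V_{i2}) : i\in[m]\}$ and positive edge set $E_k$. Let $\mathcal{D}$ be the collection of all stable bipartitions $\{X,Y\}$ of $\Sigma{:}E^-$. If $p$ is the smallest integer in $[l]$ such that $\Phi_p$ is unbalanced, then $$\max_{\{X,Y\}\in\mathcal{D}} d^+(X,Y)=w_p.$$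
   Context: A signed graph is a pair $(\Gamma,\sigma)$ with $\sigma: E(\Gamma)\to\{+,-\}$ (the auxiliary graphs $\Phi_k$ may have a positive and a negative edge between the same two vertices, forming a negative digon, which counts as a negative circle). The sign of a circle is the product of its edge signs; a signed graph is balanced if every circle is positive. $\Sigma{:}E^-$ is the subgraph of $\Sigma$ consisting of the negative edges and their endpoints. A stable bipartition of a graph is a bipartition of its vertex set into two classes each containing no edge of that graph. The positive subgraph $\Sigma^+$ has vertex set $V(\Sigma)$ and the positive edges of $\Sigma$; $d^+(x,y)$ is the distance from $x$ to $y$ in $\Sigma^+$ ($\infty$ if there is no path), and for vertex sets $X,Y$, $d^+(X,Y)=\min_{(x,y)\in X\times Y}d^+(x,y)$. $[n]=\{1,\dots,n\}$. *)

theory Defs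
  imports Main "HOL-Library.Extended_Nat" "HOL-Combinatorics.Transposition"
begin

text \<open>
  Edges are abstract objects with a set of end vertices, so that parallel edges (in particular
  a positive and a negative edge with the same ends) are available.  The signs
  \<open>+\<close> and \<open>-\<close> are the integers \<open>1\<close> and \<open>-1\<close>.
\<close>

record ('v, 'e) sgraph =
  verts :: "'v set"
  edges :: "'e set"
  ends  :: "'e \<Rightarrow> 'v set"
  esign :: "'e \<Rightarrow> int"

definition signed_graph :: "('v, 'e) sgraph \<Rightarrow> bool" where
  "signed_graph G \<longleftrightarrow>
     (\<forall>e\<in>edges G. ends G e \<subseteq> verts G \<and> card (ends G e) = 2 \<and> esign G e \<in> {1, -1})"

text \<open>
  The circle passes through the vertices of \<open>vs\<close> in cyclic order, using the edges \<open>es\<close>.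
  Length 2 (a digon) is allowed; its two edges are distinct and parallel.
\<close>

definition circle :: "('v, 'e) sgraph \<Rightarrow> 'v list \<Rightarrow> 'e list \<Rightarrow> bool" where
  "circle G vs es \<longleftrightarrow>
     2 \<le> length es \<and> length vs = length es \<and> distinct vs \<and> distinct es \<and>
     set vs \<subseteq> verts G \<and> set es \<subseteq> edges G \<and>
     (\<forall>i<length es. ends G (es ! i) = {vs ! i, vs ! (Suc i mod length es)})"

definition balanced :: "('v, 'e) sgraph \<Rightarrow> bool" where
  "balanced G \<longleftrightarrow> (\<forall>vs es. circle G vs es \<longrightarrow> prod_list (map (esign G) es) = 1)"

definition pos_subgraph :: "('v, 'e) sgraph \<Rightarrow> ('v, 'e) sgraph" where
  "pos_subgraph G = G\<lparr>edges := {e \<in> edges G. esign G e = 1}\<rparr>"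

text \<open>The graph \<open>\<Sigma>:E\<^sup>-\<close>; it has no isolated vertices.\<close>

definition neg_subgraph :: "('v, 'e) sgraph \<Rightarrow> ('v, 'e) sgraph" where
  "neg_subgraph G =
     (let N = {e \<in> edges G. esign G e = -1}
      in G\<lparr>verts := (\<Union>e\<in>N. ends G e), edges := N\<rparr>)"

definition adj :: "('v, 'e) sgraph \<Rightarrow> 'v \<Rightarrow> 'v \<Rightarrow> bool" where
  "adj G x y \<longleftrightarrow> (\<exists>e\<in>edges G. ends G e = {x, y})"

definition induced :: "('v, 'e) sgraph \<Rightarrow> 'v set \<Rightarrow> ('v, 'e) sgraph" where
  "induced G W = G\<lparr>verts := W, edges := {e \<in> edges G. ends G e \<subseteq> W}\<rparr>"

definition components :: "('v, 'e) sgraph \<Rightarrow> ('v, 'e) sgraph set" where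
  "components G = {induced G {y \<in> verts G. (adj G)\<^sup>*\<^sup>* x y} | x. x \<in> verts G}"

definition path :: "('v, 'e) sgraph \<Rightarrow> 'v \<Rightarrow> 'v list \<Rightarrow> 'v \<Rightarrow> bool" where
  "path G x vs y \<longleftrightarrow>
     vs \<noteq> [] \<and> hd vs = x \<and> last vs = y \<and> distinct vs \<and> set vs \<subseteq> verts G \<and>
     successively (adj G) vs"

text \<open>In \<^typ>\<open>enat\<close> the infimum of the empty set is \<open>\<infinity>\<close>, and a nonempty set attains its infimum.\<close>

definition gdist :: "('v, 'e) sgraph \<Rightarrow> 'v \<Rightarrow> 'v \<Rightarrow> enat" where
  "gdist G x y = Inf {enat (length vs - 1) | vs. path G x vs y}"

definition dplus :: "('v, 'e) sgraph \<Rightarrow> 'v set \<Rightarrow> 'v set \<Rightarrow> enat" where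
  "dplus G X Y = (INF (x, y)\<in>X \<times> Y. gdist (pos_subgraph G) x y)"

definition stable_bipartitions :: "('v, 'e) sgraph \<Rightarrow> 'v set set set" where
  "stable_bipartitions G =
     {{X, Y} | X Y. X \<union> Y = verts G \<and> X \<inter> Y = {} \<and>
        (\<forall>e\<in>edges G. \<not> ends G e \<subseteq> X \<and> \<not> ends G e \<subseteq> Y)}"

definition bipartite :: "('v, 'e) sgraph \<Rightarrow> bool" where
  "bipartite G \<longleftrightarrow> stable_bipartitions G \<noteq> {}"

text \<open>
  The auxiliary graph for a threshold \<open>r\<close> (to be instantiated with \<open>w\<^sub>k\<close>).  Its vertices are the
  sets \<open>V i \<alpha>\<close>, its edges are pairs of a set of ends and a sign.
\<close>

definition Phi_index :: "nat \<Rightarrow> (nat \<times> nat) set" where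
  "Phi_index m = {1..m} \<times> {1, 2}"

definition E' :: "('v, 'e) sgraph \<Rightarrow> nat \<Rightarrow> (nat \<Rightarrow> nat \<Rightarrow> 'v set) \<Rightarrow> enat \<Rightarrow> 'v set set set" where
  "E' G m V r =
     {{V i \<alpha>, V j \<beta>} | i \<alpha> j \<beta>. (i, \<alpha>) \<in> Phi_index m \<and> (j, \<beta>) \<in> Phi_index m \<and>
        (i, \<alpha>) \<noteq> (j, \<beta>) \<and> dplus G (V i \<alpha>) (V j \<beta>) \<le> r}"

definition E'' :: "('v, 'e) sgraph \<Rightarrow> nat \<Rightarrow> (nat \<Rightarrow> nat \<Rightarrow> 'v set) \<Rightarrow> enat \<Rightarrow> 'v set set set" where
  "E'' G m V r =
     (let \<tau> = transpose 1 2 in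
     {{V i (\<tau> \<alpha>), V j (\<tau> \<beta>)} | i \<alpha> j \<beta>. (i, \<alpha>) \<in> Phi_index m \<and> (j, \<beta>) \<in> Phi_index m \<and>
        (i, \<alpha>) \<noteq> (j, \<beta>) \<and> dplus G (V i \<alpha>) (V j \<beta>) \<le> r})"

definition Phi ::
  "('v, 'e) sgraph \<Rightarrow> nat \<Rightarrow> (nat \<Rightarrow> nat \<Rightarrow> 'v set) \<Rightarrow> enat \<Rightarrow> ('v set, 'v set set \<times> int) sgraph" where
  "Phi G m V r =
     \<lparr>verts = {V i \<alpha> | i \<alpha>. (i, \<alpha>) \<in> Phi_index m},
      edges = {{V i 1, V i 2} | i. i \<in> {1..m}} \<times> {-1} \<union> (E' G m V r \<union> E'' G m V r) \<times> {1},
      ends = fst,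
      esign = snd\<rparr>"

end

theory Submission
  imports Defs
begin

text \<open>
  A stable bipartition of \<open>\<Sigma>:E\<^sup>-\<close> amounts to a choice, for each component, of the side containing
  \<open>V i 1\<close>; equivalently, to a bipartition of the vertices of \<open>\<Phi>\<^sub>k\<close> that every negative edge
  crosses.  Its two classes are at positive distance more than \<open>w\<^sub>k\<close> iff no positive edge of
  \<open>\<Phi>\<^sub>k\<close> crosses, the edges in \<open>E\<^sub>k''\<close> being harmless because swapping both ends preserves
  crossing.  By Harary's theorem such a bipartition exists iff \<open>\<Phi>\<^sub>k\<close> is balanced.  Bipartitions
  are encoded as functions to \<open>{1, -1}\<close> for which the sign of an edge is the product of the values
  at its ends.
\<close>

section \<open>Harary's balance theorem\<close>

text \<open>A switching function turning the all-positive signature into \<open>esign G\<close>.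
  Values off the vertex set are constrained too, so that \<open>f x * f x = 1\<close> needs no
  membership premise.\<close>

definition potential :: "('v, 'e) sgraph \<Rightarrow> ('v \<Rightarrow> int) \<Rightarrow> bool" where
  "potential G f \<longleftrightarrow> range f \<subseteq> {1, -1} \<and>
     (\<forall>e\<in>edges G. \<forall>x y. ends G e = {x, y} \<longrightarrow> esign G e = f x * f y)"

lemma potential_edge:
  "potential G f \<Longrightarrow> e \<in> edges G \<Longrightarrow> ends G e = {x, y} \<Longrightarrow> esign G e = f x * f y"
  unfolding potential_def by blast

lemma potential_square:
  assumes "potential G f"
  shows "f x * f x = 1"
proof -
  have "f x \<in> {1, -1}"
    using assms by (auto simp: potential_def)
  then show ?thesis by auto
qed

lemma prod_list_map_nth: "prod_list (map g xs) = (\<Prod>i<length xs. g (xs ! i))"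
  for g :: "'a \<Rightarrow> 'b :: comm_monoid_mult"
  using prod.list_conv_set_nth[of "map g xs"] by (simp add: atLeast0LessThan)

text \<open>Each vertex of a circle is an end of two consecutive circle edges, so its value enters
  the product twice and cancels. The list \<open>rotate1 vs\<close> supplies the second end of each
  edge.\<close>

lemma potential_imp_balanced:
  assumes f: "potential G f"
  shows "balanced G"
  unfolding balanced_def
proof (intro allI impI)
  fix vs es assume c: "circle G vs es"
  have len: "length vs = length es" using c by (simp add: circle_def)
  have "prod_list (map (esign G) es) = (\<Prod>i<length es. esign G (es ! i))"
    by (rule prod_list_map_nth)
  also have "\<dots> = (\<Prod>i<length vs. f (vs ! i) * f (rotate1 vs ! i))"
  proof (intro prod.cong)
    fix i assume "i \<in> {..<length vs}"
    then have "es ! i \<in> edges G" "ends G (es ! i) = {vs ! i, rotate1 vs ! i}"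
      using c len by (auto simp: circle_def nth_rotate1)
    with f show "esign G (es ! i) = f (vs ! i) * f (rotate1 vs ! i)"
      by (rule potential_edge)
  qed (simp add: len)
  also have "\<dots> = prod_list (map f vs) * prod_list (map f (rotate1 vs))"
    by (simp add: prod.distrib prod_list_map_nth)
  also have "prod_list (map f (rotate1 vs)) = prod_list (map f vs)"
    by (cases vs) (simp_all add: mult.commute)
  also have "prod_list (map f vs) * prod_list (map f vs) = 1"
  proof (induction vs)
    case (Cons a vs)
    have "prod_list (map f (a # vs)) * prod_list (map f (a # vs)) =
        (f a * f a) * (prod_list (map f vs) * prod_list (map f vs))"
      by (simp add: mult_ac)
    then show ?case using Cons potential_square[OF f] by simp
  qed simp
  finally show "prod_list (map (esign G) es) = 1" .
qed

text \<open>A walk is listed as pairs of an edge and the vertex from which the edge is traversed.\<close>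

fun walk :: "('v, 'e) sgraph \<Rightarrow> 'v \<Rightarrow> ('v \<times> 'e) list \<Rightarrow> 'v \<Rightarrow> bool" where
  "walk G x [] y \<longleftrightarrow> x = y"
| "walk G x ((u, e) # ps) y \<longleftrightarrow>
     u = x \<and> e \<in> edges G \<and> (\<exists>z. ends G e = {x, z} \<and> walk G z ps y)"

definition walk_sign :: "('v, 'e) sgraph \<Rightarrow> ('v \<times> 'e) list \<Rightarrow> int" where
  "walk_sign G ps = prod_list (map (esign G \<circ> snd) ps)"

lemma walk_sign_simps [simp]:
  "walk_sign G [] = 1"
  "walk_sign G ((u, e) # ps) = esign G e * walk_sign G ps"
  "walk_sign G (ps @ qs) = walk_sign G ps * walk_sign G qs"
  by (simp_all add: walk_sign_def)

lemma walk_append: "walk G x (ps @ qs) y \<longleftrightarrow> (\<exists>z. walk G x ps z \<and> walk G z qs y)"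
  by (induction ps arbitrary: x) (fastforce, force)

lemma walk_rev:
  assumes "walk G x ps y"
  shows "\<exists>qs. walk G y qs x \<and> walk_sign G qs = walk_sign G ps"
  using assms
proof (induction ps arbitrary: x)
  case (Cons a ps)
  obtain u e where a: "a = (u, e)" by force
  with Cons.prems obtain z where z: "u = x" "e \<in> edges G" "ends G e = {x, z}" "walk G z ps y"
    by auto
  from Cons.IH[OF z(4)] obtain qs where "walk G y qs z" "walk_sign G qs = walk_sign G ps"
    by auto
  with z have "walk G y (qs @ [(z, e)]) x \<and>
      walk_sign G (qs @ [(z, e)]) = walk_sign G (a # ps)"
    unfolding walk_append a by (auto simp: mult.commute insert_commute)
  then show ?case by blast
qed (auto intro: exI[of _ "[]"])

lemma walk_sign_cases:
  assumes "signed_graph G" "walk G x ps y"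
  shows "walk_sign G ps \<in> {1, -1}"
  using assms(2)
proof (induction ps arbitrary: x)
  case (Cons a ps)
  obtain u e where a: "a = (u, e)" by force
  with Cons.prems have "e \<in> edges G" and "walk_sign G ps \<in> {1, -1}"
    using Cons.IH by auto
  moreover have "esign G e \<in> {1, -1}"
    using assms(1) \<open>e \<in> edges G\<close> by (auto simp: signed_graph_def)
  ultimately show ?case by (auto simp: a)
qed simp

lemma walk_edges: "walk G x ps y \<Longrightarrow> snd ` set ps \<subseteq> edges G"
proof (induction ps arbitrary: x)
  case (Cons a ps)
  then show ?case by (cases a) auto
qed simp

section \<open>Closed walks and circles\<close>

lemma walk_ends_nth:
  assumes "walk G x ps y" "i < length ps"
  shows "ends G (snd (ps ! i)) = {fst (ps ! i), if Suc i < length ps then fst (ps ! Suc i) else y}"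
  using assms
proof (induction ps arbitrary: x i)
  case (Cons a ps)
  obtain u e where a: "a = (u, e)" by force
  with Cons.prems obtain z where z: "u = x" "ends G e = {x, z}" "walk G z ps y"
    by auto
  show ?case
  proof (cases i)
    case 0
    have "fst (ps ! 0) = z" if "ps \<noteq> []"
      using z(3) that by (cases ps) auto
    moreover have "z = y" if "ps = []" using z(3) that by simp
    ultimately show ?thesis using z(1,2) a 0 by auto
  next
    case (Suc j)
    then show ?thesis using Cons.IH[OF z(3), of j] Cons.prems by auto
  qed
qed simp

lemma closed_walk_ends_nth:
  assumes "walk G x ps x" "i < length ps"
  shows "ends G (snd (ps ! i)) = {fst (ps ! i), fst (ps ! (Suc i mod length ps))}"
proof -
  have "ps \<noteq> []" using assms by auto
  then have "fst (ps ! 0) = x" using assms(1) by (cases ps) auto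
  moreover have "Suc i mod length ps = (if Suc i < length ps then Suc i else 0)"
    using assms(2) by (simp add: mod_Suc)
  ultimately show ?thesis using walk_ends_nth[OF assms] by simp
qed

text \<open>Distinct departure vertices do not by themselves prevent an edge from being used twice;
  the negative sign does, and it also excludes the empty walk.\<close>

lemma closed_walk_circle:
  assumes G: "signed_graph G" and w: "walk G x ps x"
    and d: "distinct (map fst ps)" and neg: "walk_sign G ps \<noteq> 1"
  shows "circle G (map fst ps) (map snd ps)"
proof -
  let ?n = "length ps"
  have c2: "card (ends G (snd (ps ! i))) = 2" "ends G (snd (ps ! i)) \<subseteq> verts G"
    "esign G (snd (ps ! i)) * esign G (snd (ps ! i)) = 1"
    if "i < ?n" for i
    
  proof -
    have "snd (ps ! i) \<in> edges G" using walk_edges[OF w] nth_mem[OF that] by auto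
    then show "card (ends G (snd (ps ! i))) = 2" "ends G (snd (ps ! i)) \<subseteq> verts G"
      "esign G (snd (ps ! i)) * esign G (snd (ps ! i)) = 1"
      using G unfolding signed_graph_def by auto
  qed
  note en = closed_walk_ends_nth[OF w]
  \<comment> \<open>The empty walk is positive, and a closed walk of length one would run along a
    loop.\<close>
  have "?n \<noteq> 0" using neg by auto
  moreover have "?n \<noteq> 1" using c2(1)[of 0] en[of 0] by (cases "?n = 1") auto
  ultimately have n2: "2 \<le> ?n" by linarith
  have sub: "fst ` set ps \<subseteq> verts G"
    using c2(2) en by (force simp: in_set_conv_nth)
  have inj: "i = j" if ij: "i < ?n" "j < ?n" and eq: "snd (ps ! i) = snd (ps ! j)" for i j
  proof (rule ccontr)
    assume ne: "i \<noteq> j"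
    let ?s = "\<lambda>i. Suc i mod ?n"
    have dn: "a = b" if "fst (ps ! a) = fst (ps ! b)" "a < ?n" "b < ?n" for a b
      using d that by (metis length_map nth_eq_iff_index_eq nth_map)
    have lt: "?s i < ?n" "?s j < ?n" using ij by (auto intro: mod_less_divisor)
    \<comment> \<open>Equal edges with different departure vertices are traversed in opposite
      directions, so each position is the cyclic successor of the other.\<close>
    have "{fst (ps ! i), fst (ps ! ?s i)} = {fst (ps ! j), fst (ps ! ?s j)}"
      using en ij eq by metis
    then have "fst (ps ! i) = fst (ps ! ?s j)" "fst (ps ! j) = fst (ps ! ?s i)"
      using dn ij ne by (metis doubleton_eq_iff)+
    then have "i = ?s j" "j = ?s i" using dn ij lt by blast+
    \<comment> \<open>An edge is used twice only by a walk of length two going forth and back, which is positive.\<close>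
    have "Suc a = ?n \<and> ?s a = 0 \<or> Suc a < ?n \<and> ?s a = Suc a" if "a < ?n" for a
      using that by (auto simp: mod_Suc)
    from this[OF ij(1)] this[OF ij(2)] \<open>i = ?s j\<close> \<open>j = ?s i\<close> have "?n = 2"
      using ne by linarith
    then obtain a b where ps: "ps = [a, b]"
      by (auto simp: length_Suc_conv numeral_2_eq_2)
    have "snd a = snd b" using eq ne ij ps by (auto simp: less_Suc_eq)
    then have "walk_sign G ps = 1" using c2(3)[of 0] ps by (simp add: walk_sign_def)
    with neg show False by simp
  qed
  then have "distinct (map snd ps)" by (auto simp: distinct_conv_nth)
  moreover have "Suc i mod ?n < ?n" for i
    using n2 by (intro mod_less_divisor) linarith
  ultimately show ?thesis using n2 d sub walk_edges[OF w] en
    by (auto simp: circle_def nth_map)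
qed

text \<open>Either no departure vertex repeats and the walk, if it were negative, would be a
  negative circle, or a repeated vertex splits it into two shorter closed walks whose signs multiply
  to its own.\<close>

lemma balanced_closed_walk:
  assumes G: "signed_graph G" and b: "balanced G" and w: "walk G x ps x"
  shows "walk_sign G ps = 1"
  using w
proof (induction "length ps" arbitrary: x ps rule: less_induct)
  case less
  show ?case
  proof (cases "distinct (map fst ps)")
    case True
    show ?thesis
    proof (rule ccontr)
      assume neg: "walk_sign G ps \<noteq> 1"
      from closed_walk_circle[OF G less.prems True neg] b
      have "prod_list (map (esign G) (map snd ps)) = 1" by (simp add: balanced_def del: map_map)
      with neg show False by (simp add: walk_sign_def)
    qed
  next
    case False
    \<comment> \<open>The repetition of \<open>v\<close> in \<open>map fst ps\<close> is pulled
      back, piece by piece, to a decomposition of \<open>ps\<close> itself.\<close>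
    then obtain as v bs cs where "map fst ps = as @ [v] @ bs @ [v] @ cs"
      using not_distinct_decomp by blast
    then obtain p1 r where r: "ps = p1 @ r" "map fst r = v # bs @ v # cs"
      by (metis map_eq_append_conv append_Cons append_Nil)
    then obtain a qs where a: "r = a # qs" "fst a = v" "map fst qs = bs @ v # cs"
      by (metis map_eq_Cons_conv)
    then obtain p2 s where s: "qs = p2 @ s" "map fst s = v # cs"
      by (metis map_eq_append_conv)
    then obtain b p3 where "s = b # p3" "fst b = v"
      by (metis map_eq_Cons_conv)
    with r(1) a s obtain e f where ps: "ps = p1 @ ((v, e) # p2) @ ((v, f) # p3)"
      by (cases a, cases b) auto
    with less.prems have "walk G x p1 v" "walk G v ((v, e) # p2) v" "walk G v ((v, f) # p3) x"
      by (auto simp: walk_append)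
    then have w2: "walk G v ((v, e) # p2) v" and w13: "walk G x (p1 @ ((v, f) # p3)) x"
      unfolding walk_append by blast+
    have "walk_sign G ((v, e) # p2) = 1" "walk_sign G (p1 @ ((v, f) # p3)) = 1"
      using less.hyps[OF _ w2] less.hyps[OF _ w13] by (simp_all add: ps)
    moreover have "walk_sign G ps = walk_sign G ((v, e) # p2) * walk_sign G (p1 @ ((v, f) # p3))"
      by (simp add: ps mult_ac)
    ultimately show ?thesis by simp
  qed
qed

lemma balanced_walk_sign_eq:
  assumes G: "signed_graph G" and b: "balanced G" and "walk G x ps y" "walk G x qs y"
  shows "walk_sign G ps = walk_sign G qs"
proof -
  obtain rs where rs: "walk G y rs x" "walk_sign G rs = walk_sign G qs"
    using walk_rev assms(4) by metis
  have "walk G x (ps @ rs) x" using assms(3) rs(1) by (auto simp: walk_append)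
  from balanced_closed_walk[OF G b this] have "walk_sign G ps * walk_sign G qs = 1"
    using rs by simp
  then show ?thesis
    using walk_sign_cases[OF G assms(3)] walk_sign_cases[OF G assms(4)] by auto
qed

text \<open>The value at a vertex is the sign of any walk from a root chosen in its connectivity
  class. Balance makes this independent of the walk, and appending an edge multiplies the value by
  the sign of that edge.\<close>

lemma balanced_imp_potential:
  assumes G: "signed_graph G" and b: "balanced G"
  obtains f where "potential G f"
proof -
  define conn where "conn x y \<longleftrightarrow> (\<exists>ps. walk G x ps y)" for x y
  \<comment> \<open>The empty walk starts at any element of the type, vertex or not, so roots and
    values exist everywhere.\<close>
  have refl: "conn x x" for x unfolding conn_def by (rule exI[of _ "[]"]) simp
  have sym: "conn x y \<Longrightarrow> conn y x" for x y using walk_rev unfolding conn_def by metis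
  have trans: "conn x y \<Longrightarrow> conn y z \<Longrightarrow> conn x z" for x y z
    unfolding conn_def by (metis walk_append)
  define root where "root x = (SOME r. conn r x)" for x
  have root: "conn (root x) x" for x unfolding root_def by (rule someI, rule refl)
  have root_eq: "root x = root y" if "conn x y" for x y
  proof -
    have "conn r x = conn r y" for r using that sym trans by blast
    then show ?thesis unfolding root_def by simp
  qed
  define f where "f x = walk_sign G (SOME ps. walk G (root x) ps x)" for x
  have some: "walk G (root x) (SOME ps. walk G (root x) ps x) x" for x
    using root[of x] unfolding conn_def by (rule someI_ex)
  have f: "f x = walk_sign G ps" if "walk G (root x) ps x" for x ps
    unfolding f_def using balanced_walk_sign_eq[OF G b some that] .
  have rng: "f x \<in> {1, -1}" for x
    unfolding f_def using walk_sign_cases[OF G some] .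
  have "esign G e = f x * f y" if e: "e \<in> edges G" "ends G e = {x, y}" for e x y
  proof -
    have xy: "walk G x [(x, e)] y" using e by simp
    then have eq: "root x = root y" using root_eq conn_def by blast
    obtain ps where ps: "walk G (root x) ps x" using root conn_def by blast
    have "walk G (root y) (ps @ [(x, e)]) y"
      using ps xy eq unfolding walk_append by metis
    from f[OF this] f[OF ps] have "f y = f x * esign G e" by simp
    then show ?thesis using rng[of x] by auto
  qed
  with rng have "potential G f" by (auto simp: potential_def)
  then show thesis by (rule that)
qed

section \<open>Distances in the positive subgraph\<close>

text \<open>If no element is at most \<open>n\<close>, then \<open>eSuc (enat n)\<close> is a lower
  bound. Finiteness of the bound matters: with \<open>\<infinity>\<close> the equivalence fails for
  the empty set.\<close>

lemma Inf_enat_le_iff: "Inf A \<le> enat n \<longleftrightarrow> (\<exists>a\<in>A. a \<le> enat n)"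
proof
  show "\<exists>a\<in>A. a \<le> enat n" if "Inf A \<le> enat n"
  proof (rule ccontr)
    assume "\<not> ?thesis"
    then have "eSuc (enat n) \<le> Inf A"
      by (intro Inf_greatest ileI1) (auto simp: not_le)
    with that show False
      by (metis eSuc_enat enat_ord_simps(1) not_less_eq_eq order.refl order.trans)
  qed
qed (meson Inf_lower order.trans)

lemma dplus_le_iff:
  "dplus G X Y \<le> enat n \<longleftrightarrow> (\<exists>x\<in>X. \<exists>y\<in>Y. gdist (pos_subgraph G) x y \<le> enat n)"
  unfolding dplus_def Inf_enat_le_iff by auto

lemma dplus_antimono: "A \<subseteq> X \<Longrightarrow> B \<subseteq> Y \<Longrightarrow> dplus G X Y \<le> dplus G A B"
  unfolding dplus_def by (rule INF_superset_mono) auto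

lemma path_rev: "path G x vs y \<Longrightarrow> path G y (rev vs) x"
  by (auto simp: path_def hd_rev last_rev adj_def insert_commute)

lemma gdist_commute: "gdist G x y = gdist G y x"
proof -
  have sub: "{enat (length vs - 1) | vs. path G x vs y} \<subseteq> {enat (length vs - 1) | vs. path G y vs x}"
    for x y
  proof
    fix n assume "n \<in> {enat (length vs - 1) | vs. path G x vs y}"
    then obtain vs where "n = enat (length (rev vs) - 1)" "path G x vs y" by auto
    then show "n \<in> {enat (length vs - 1) | vs. path G y vs x}"
      by (intro CollectI exI[of _ "rev vs"] conjI path_rev)
  qed
  show ?thesis unfolding gdist_def by (intro arg_cong[of _ _ Inf] equalityI sub)
qed

text \<open>Edges of \<open>Phi\<close> are unordered while \<open>dplus\<close> takes an ordered
  pair; reversing paths reconciles the two.\<close>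

lemma dplus_commute: "dplus G X Y = dplus G Y X"
proof -
  have "dplus G Y X \<le> dplus G X Y" for X Y
  proof (unfold dplus_def, rule INF_mono)
    fix xy assume "xy \<in> X \<times> Y"
    then show "\<exists>yx\<in>Y \<times> X. (case yx of (x, y) \<Rightarrow> gdist (pos_subgraph G) x y)
        \<le> (case xy of (x, y) \<Rightarrow> gdist (pos_subgraph G) x y)"
      by (intro bexI[of _ "prod.swap xy"]) (auto simp: gdist_commute)
  qed
  then show ?thesis by (simp add: order.antisym)
qed

section \<open>Components of the negative subgraph\<close>

lemma stable_bipartitionD:
  assumes "{X, Y} \<in> stable_bipartitions G"
  shows "X \<union> Y = verts G" "X \<inter> Y = {}"
    "\<And>e. e \<in> edges G \<Longrightarrow> \<not> ends G e \<subseteq> X" "\<And>e. e \<in> edges G \<Longrightarrow> \<not> ends G e \<subseteq> Y"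
  using assms unfolding stable_bipartitions_def by (auto simp: doubleton_eq_iff)

lemma stable_bipartitionI:
  assumes "X \<union> Y = verts G" "X \<inter> Y = {}"
    "\<And>e. e \<in> edges G \<Longrightarrow> \<not> ends G e \<subseteq> X \<and> \<not> ends G e \<subseteq> Y"
  shows "{X, Y} \<in> stable_bipartitions G"
  unfolding stable_bipartitions_def using assms
  by (intro CollectI exI[of _ X] exI[of _ Y]) simp

text \<open>\<open>C\<close> enumerates the components without repetition. Which side of a component
  carries the label 1 is arbitrary.\<close>

locale negative_components =
  fixes \<Sigma> :: "('v, 'e) sgraph" and m :: nat and C :: "nat \<Rightarrow> ('v, 'e) sgraph"
    and V :: "nat \<Rightarrow> nat \<Rightarrow> 'v set"
  assumes sg: "signed_graph \<Sigma>"
    and C: "bij_betw C {1..m} (components (neg_subgraph \<Sigma>))"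
    and V: "\<And>i. i \<in> {1..m} \<Longrightarrow> {V i 1, V i 2} \<in> stable_bipartitions (C i)"
begin

abbreviation H where "H \<equiv> neg_subgraph \<Sigma>"

abbreviation ix where "ix \<equiv> Phi_index m"

lemma H_edge:
  assumes "e \<in> edges H"
  obtains x y where "ends H e = {x, y}" "x \<noteq> y" "x \<in> verts H" "y \<in> verts H"
proof -
  have "card (ends H e) = 2" "ends H e \<subseteq> verts H"
    using assms sg by (auto simp: neg_subgraph_def signed_graph_def Let_def)
  then show thesis using that by (auto simp: card_2_iff)
qed

lemma H_vertex:
  assumes "x \<in> verts H"
  obtains e where "e \<in> edges H" "x \<in> ends H e"
  using assms by (auto simp: neg_subgraph_def Let_def)

lemma adj_H_verts: "adj H x y \<Longrightarrow> x \<in> verts H \<and> y \<in> verts H"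
  unfolding adj_def using H_edge by (metis doubleton_eq_iff)

lemma adj_H_rtranclp_sym: "(adj H)\<^sup>*\<^sup>* x y \<Longrightarrow> (adj H)\<^sup>*\<^sup>* y x"
  by (rule sympD[OF symp_rtranclp]) (auto simp: symp_def adj_def insert_commute)

text \<open>Reachability is symmetric and transitive, so any vertex of a component can replace the
  representative that defines it.\<close>

lemma component_eq:
  assumes "i \<in> {1..m}" "x \<in> verts (C i)"
  shows "C i = induced H {y \<in> verts H. (adj H)\<^sup>*\<^sup>* x y}" "x \<in> verts H"
proof -
  have "C i \<in> components H" using C assms(1) by (auto simp: bij_betw_def)
  then obtain z where z: "C i = induced H {y \<in> verts H. (adj H)\<^sup>*\<^sup>* z y}"
    unfolding components_def by auto
  with assms(2) have x: "x \<in> verts H" "(adj H)\<^sup>*\<^sup>* z x" by (auto simp: induced_def)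
  then have "(adj H)\<^sup>*\<^sup>* z y = (adj H)\<^sup>*\<^sup>* x y" for y
    using adj_H_rtranclp_sym by (meson rtranclp_trans)
  with z x show "C i = induced H {y \<in> verts H. (adj H)\<^sup>*\<^sup>* x y}" "x \<in> verts H" by auto
qed

lemma component_ex:
  assumes "x \<in> verts H"
  obtains i where "i \<in> {1..m}" "x \<in> verts (C i)"
proof -
  have "induced H {y \<in> verts H. (adj H)\<^sup>*\<^sup>* x y} \<in> components H"
    using assms unfolding components_def by blast
  then obtain i where "i \<in> {1..m}" "C i = induced H {y \<in> verts H. (adj H)\<^sup>*\<^sup>* x y}"
    using bij_betw_imp_surj_on[OF C] by (auto elim!: equalityE)
  with that assms show thesis by (auto simp: induced_def)
qed

lemma component_unique:
  assumes "i \<in> {1..m}" "j \<in> {1..m}" "x \<in> verts (C i)" "x \<in> verts (C j)"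
  shows "i = j"
proof -
  have "C i = C j"
    using component_eq(1)[OF assms(1,3)] component_eq(1)[OF assms(2,4)] by simp
  then show ?thesis using inj_onD[OF bij_betw_imp_inj_on[OF C]] assms by blast
qed

lemma component_edge:
  assumes "i \<in> {1..m}" "e \<in> edges H" "x \<in> ends H e" "x \<in> verts (C i)"
  shows "e \<in> edges (C i)" "ends (C i) e = ends H e" "ends H e \<subseteq> verts (C i)"
proof -
  obtain a b where "ends H e = {a, b}" "a \<in> verts H" "b \<in> verts H"
    using H_edge[OF assms(2)] by metis
  then obtain y where y: "ends H e = {x, y}" "y \<in> verts H"
    using assms(3) by (cases "x = a") (auto simp: insert_commute)
  have "adj H x y" using y assms(2) by (auto simp: adj_def)
  with y component_eq[OF assms(1,4)] assms(2)
  show "e \<in> edges (C i)" "ends (C i) e = ends H e" "ends H e \<subseteq> verts (C i)"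
    by (auto simp: induced_def)
qed

lemma component_nonempty:
  assumes "i \<in> {1..m}"
  obtains x where "x \<in> verts (C i)"
proof -
  have "C i \<in> components H" using C assms(1) by (auto simp: bij_betw_def)
  then obtain x where "x \<in> verts H" "C i = induced H {y \<in> verts H. (adj H)\<^sup>*\<^sup>* x y}"
    unfolding components_def by auto
  then have "x \<in> verts (C i)" by (simp add: induced_def)
  then show thesis by (rule that)
qed

lemma ix_iff: "(i, a) \<in> ix \<longleftrightarrow> i \<in> {1..m} \<and> (a = 1 \<or> a = 2)"
  by (auto simp: Phi_index_def)

lemma V_subset: "(i, a) \<in> ix \<Longrightarrow> V i a \<subseteq> verts (C i)"
  using stable_bipartitionD(1)[OF V] unfolding ix_iff by blast

text \<open>Every vertex of \<open>H\<close> lies on a negative edge, and that edge stays inside the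
  component; were one side empty, the other would contain both of its ends.\<close>

lemma V_nonempty:
  assumes "(i, a) \<in> ix"
  shows "V i a \<noteq> {}"
proof
  assume emp: "V i a = {}"
  have i: "i \<in> {1..m}" using assms by (simp add: ix_iff)
  obtain x where x: "x \<in> verts (C i)" using component_nonempty[OF i] .
  obtain e where e: "e \<in> edges H" "x \<in> ends H e" using component_eq(2)[OF i x] H_vertex by blast
  note ce = component_edge[OF i e x] and sb = stable_bipartitionD[OF V[OF i]]
  have "ends (C i) e \<subseteq> V i 1 \<or> ends (C i) e \<subseteq> V i 2"
    using emp assms sb(1) ce(2,3) by (auto simp: ix_iff)
  with sb(3,4)[OF ce(1)] show False by blast
qed

lemma V_disjoint:
  assumes "(i, a) \<in> ix" "(j, b) \<in> ix" "(i, a) \<noteq> (j, b)"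
  shows "V i a \<inter> V j b = {}"
proof (cases "i = j")
  case True
  then show ?thesis
    using assms stable_bipartitionD(2)[OF V, of i] by (auto simp: ix_iff)
next
  case False
  then have "verts (C i) \<inter> verts (C j) = {}"
    using component_unique[of i j] assms(1,2) by (auto simp: ix_iff)
  then show ?thesis using V_subset[OF assms(1)] V_subset[OF assms(2)] by blast
qed

lemma V_cover:
  assumes "x \<in> verts H"
  obtains i a where "(i, a) \<in> ix" "x \<in> V i a"
proof -
  obtain i where i: "i \<in> {1..m}" "x \<in> verts (C i)" using component_ex[OF assms] .
  then have "x \<in> V i 1 \<union> V i 2" using stable_bipartitionD(1)[OF V] by metis
  with i that show thesis unfolding ix_iff by blast
qed

text \<open>The vertices of \<open>Phi\<close> are sets; this lets them be identified with their
  index pairs, and hence shows that \<open>Phi\<close> has no loops.\<close>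

lemma V_inj: "(i, a) \<in> ix \<Longrightarrow> (j, b) \<in> ix \<Longrightarrow> V i a = V j b \<Longrightarrow> (i, a) = (j, b)"
  using V_disjoint V_nonempty by (metis inf.idem)

text \<open>Uniqueness of the stable bipartition of a connected graph: each edge changes sides in
  both bipartitions, so whether membership in \<open>V i 1\<close> agrees with membership in
  \<open>X\<close> is constant along walks from \<open>x\<close>.\<close>

lemma bipartition_component:
  assumes XY: "{X, Y} \<in> stable_bipartitions H" and i: "i \<in> {1..m}"
  shows "V i 1 \<subseteq> X \<and> V i 2 \<subseteq> Y \<or> V i 1 \<subseteq> Y \<and> V i 2 \<subseteq> X"
proof -
  note sX = stable_bipartitionD[OF XY] and sV = stable_bipartitionD[OF V[OF i]]
  obtain x where x: "x \<in> verts (C i)" using component_nonempty[OF i] .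
  note xC = component_eq[OF i x]
  have vC: "verts (C i) = {y \<in> verts H. (adj H)\<^sup>*\<^sup>* x y}"
    using xC(1) by (simp add: induced_def)
  have inv: "y \<in> verts (C i) \<and> ((y \<in> V i 1 \<longleftrightarrow> y \<in> X) \<longleftrightarrow> (x \<in> V i 1 \<longleftrightarrow> x \<in> X))"
    if "(adj H)\<^sup>*\<^sup>* x y" for y
    using that
  proof induction
    case base
    then show ?case using x by simp
  next
    case (step y z)
    then have y: "y \<in> verts (C i)" by simp
    obtain e where e: "e \<in> edges H" "ends H e = {y, z}" using step(2) by (auto simp: adj_def)
    note ce = component_edge[OF i e(1) _ y]
    have ce: "e \<in> edges (C i)" "ends (C i) e = {y, z}" "z \<in> verts (C i)"
      using ce e by auto
    have "y \<in> V i 1 \<longleftrightarrow> z \<notin> V i 1" using sV(1) sV(2) sV(3,4)[OF ce(1)] ce y by auto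
    moreover have "y \<in> X \<longleftrightarrow> z \<notin> X"
      using sX(1) sX(2) sX(3,4)[OF e(1)] e adj_H_verts[OF step(2)] by auto
    ultimately show ?case using step ce by auto
  qed
  have *: "(y \<in> V i 1 \<longleftrightarrow> y \<in> X) \<longleftrightarrow> (x \<in> V i 1 \<longleftrightarrow> x \<in> X)" "y \<in> X \<union> Y"
    if "y \<in> verts (C i)" for y
    using that inv[of y] sX(1) unfolding vC by blast+
  show ?thesis
  proof (cases "x \<in> V i 1 \<longleftrightarrow> x \<in> X")
    case True
    then have "y \<in> V i 1 \<longleftrightarrow> y \<in> X" "y \<in> X \<union> Y" if "y \<in> V i 1 \<union> V i 2" for y
      using * that sV(1) by auto
    then show ?thesis using sV(2) sX(2) by blast
  next
    case False
    then have "y \<in> V i 1 \<longleftrightarrow> y \<notin> X" "y \<in> X \<union> Y" if "y \<in> V i 1 \<union> V i 2" for y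
      using * that sV(1) by auto
    then show ?thesis using sV(2) sX(2) by blast
  qed
qed

lemma bipartition_side:
  assumes "{X, Y} \<in> stable_bipartitions H" "(i, a) \<in> ix"
  shows "V i a \<subseteq> X \<or> V i a \<subseteq> Y"
  using bipartition_component[OF assms(1), of i] assms(2) by (auto simp: ix_iff)

section \<open>Potentials on the auxiliary graphs\<close>

lemma Phi_simps:
  "verts (Phi \<Sigma> m V r) = {V i a | i a. (i, a) \<in> ix}"
  "edges (Phi \<Sigma> m V r) =
     {{V i 1, V i 2} | i. i \<in> {1..m}} \<times> {-1} \<union> (E' \<Sigma> m V r \<union> E'' \<Sigma> m V r) \<times> {1}"
  "ends (Phi \<Sigma> m V r) = fst" "esign (Phi \<Sigma> m V r) = snd"
  by (simp_all add: Phi_def)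

lemma swap_ix [simp]: "(i, transpose (Suc 0) 2 a) \<in> ix \<longleftrightarrow> (i, a) \<in> ix"
  by (auto simp: ix_iff transpose_def)

text \<open>As the transposition is an involution, an edge from \<open>E''\<close> is a pair that
  becomes near after swapping both labels; this treats both kinds of positive edge
  uniformly.\<close>

lemma Phi_positive_edge:
  assumes "s \<in> E' \<Sigma> m V r \<union> E'' \<Sigma> m V r"
  obtains i a j b where "s = {V i a, V j b}" "(i, a) \<in> ix" "(j, b) \<in> ix" "(i, a) \<noteq> (j, b)"
    "dplus \<Sigma> (V i a) (V j b) \<le> r \<or>
     dplus \<Sigma> (V i (transpose 1 2 a)) (V j (transpose 1 2 b)) \<le> r"
  using assms
proof
  assume "s \<in> E' \<Sigma> m V r"
  with that show thesis unfolding E'_def by blast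
next
  assume "s \<in> E'' \<Sigma> m V r"
  then obtain i a j b where *: "s = {V i (transpose 1 2 a), V j (transpose 1 2 b)}"
    "(i, a) \<in> ix" "(j, b) \<in> ix" "(i, a) \<noteq> (j, b)" "dplus \<Sigma> (V i a) (V j b) \<le> r"
    unfolding E''_def Let_def by blast
  show thesis by (rule that[of i "transpose 1 2 a" j "transpose 1 2 b"]) (use * in \<open>auto simp: transpose_eq_iff\<close>)
qed

lemma signed_graph_Phi: "signed_graph (Phi \<Sigma> m V r)"
  unfolding signed_graph_def Phi_simps
proof
  fix e assume "e \<in> {{V i 1, V i 2} | i. i \<in> {1..m}} \<times> {-1::int} \<union>
    (E' \<Sigma> m V r \<union> E'' \<Sigma> m V r) \<times> {1}"
  then have e: "fst e \<in> {{V i 1, V i 2} | i. i \<in> {1..m}} \<or> fst e \<in> E' \<Sigma> m V r \<union> E'' \<Sigma> m V r"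
    "snd e \<in> {1, -1}"
    by (cases e; simp; blast)+
  have ex: "\<exists>i a j b. s = {V i a, V j b} \<and> (i, a) \<in> ix \<and> (j, b) \<in> ix \<and> (i, a) \<noteq> (j, b)"
    if "s \<in> {{V i 1, V i 2} | i. i \<in> {1..m}} \<or> s \<in> E' \<Sigma> m V r \<union> E'' \<Sigma> m V r" for s
    using that
  proof
    assume "s \<in> {{V i 1, V i 2} | i. i \<in> {1..m}}"
    then obtain i where "i \<in> {1..m}" "s = {V i 1, V i 2}" by blast
    then show ?thesis
      by (intro exI[of _ i] exI[of _ 1] exI[of _ i] exI[of _ 2]) (simp add: ix_iff)
  next
    assume "s \<in> E' \<Sigma> m V r \<union> E'' \<Sigma> m V r"
    then show ?thesis by (rule Phi_positive_edge) blast
  qed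
  obtain i a j b where *: "fst e = {V i a, V j b}" "(i, a) \<in> ix" "(j, b) \<in> ix"
    "(i, a) \<noteq> (j, b)"
    using ex[OF e(1)] by (elim exE conjE)
  then have "V i a \<noteq> V j b" using V_inj[OF *(2,3)] by blast
  with * e(2) show "fst e \<subseteq> {V i a | i a. (i, a) \<in> ix} \<and> card (fst e) = 2 \<and> snd e \<in> {1, - 1}"
    by auto
qed

text \<open>Near vertices of \<open>X\<close> and \<open>Y\<close> belong to \<open>H\<close>, hence
  to some sides \<open>V i a\<close> and \<open>V j b\<close>, and each side lies wholly in one
  class.\<close>

lemma bipartition_dplus_le:
  assumes XY: "{X, Y} \<in> stable_bipartitions H" and le: "dplus \<Sigma> X Y \<le> enat n"
  obtains i a j b where "(i, a) \<in> ix" "(j, b) \<in> ix" "(i, a) \<noteq> (j, b)" "V i a \<subseteq> X" "V j b \<subseteq> Y"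
    "dplus \<Sigma> (V i a) (V j b) \<le> enat n"
proof -
  note sX = stable_bipartitionD[OF XY]
  obtain x y where xy: "x \<in> X" "y \<in> Y" "gdist (pos_subgraph \<Sigma>) x y \<le> enat n"
    using le unfolding dplus_le_iff by blast
  obtain i a where ia: "(i, a) \<in> ix" "x \<in> V i a" using V_cover xy sX(1) by blast
  obtain j b where jb: "(j, b) \<in> ix" "y \<in> V j b" using V_cover xy sX(1) by blast
  have X: "V i a \<subseteq> X" using bipartition_side[OF XY ia(1)] ia xy sX(2) by blast
  have Y: "V j b \<subseteq> Y" using bipartition_side[OF XY jb(1)] jb xy sX(2) by blast
  have "(i, a) \<noteq> (j, b)" using X Y V_nonempty[OF ia(1)] sX(2) by blast
  moreover have "dplus \<Sigma> (V i a) (V j b) \<le> enat n"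
    unfolding dplus_le_iff using ia jb xy by blast
  ultimately show thesis using that ia jb X Y by blast
qed

text \<open>The class containing each side gives a potential: a near pair of sides in different
  classes would bring \<open>X\<close> and \<open>Y\<close> within distance
  \<open>r\<close>.\<close>

lemma far_bipartition_imp_balanced:
  assumes XY: "{X, Y} \<in> stable_bipartitions H" and far: "\<not> dplus \<Sigma> X Y \<le> r"
  shows "balanced (Phi \<Sigma> m V r)"
proof -
  define f :: "'v set \<Rightarrow> int" where "f S = (if S \<subseteq> X then 1 else -1)" for S
  note sX = stable_bipartitionD(2)[OF XY]
  \<comment> \<open>Nonemptiness keeps a side from being contained in both classes.\<close>
  have f1: "f (V i a) = 1 \<longleftrightarrow> V i a \<subseteq> X" "f (V i a) = -1 \<longleftrightarrow> V i a \<subseteq> Y" if "(i, a) \<in> ix" for i a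
    using bipartition_side[OF XY that] V_nonempty[OF that] sX unfolding f_def by auto
  have rng: "f S = 1 \<or> f S = -1" for S by (auto simp: f_def)
  have neg: "f (V i 2) = - f (V i 1)" if i: "i \<in> {1..m}" for i
  proof -
    have "(i, 1) \<in> ix" "(i, 2) \<in> ix" using i by (auto simp: ix_iff)
    from bipartition_component[OF XY i] f1[OF this(1)] f1[OF this(2)] show ?thesis by auto
  qed
  have swap: "f (V i (transpose 1 2 a)) = - f (V i a)" if "(i, a) \<in> ix" for i a
    using that neg[of i] by (auto simp: ix_iff transpose_def)
  have near: "f (V i a) = f (V j b)"
    if "(i, a) \<in> ix" "(j, b) \<in> ix" "dplus \<Sigma> (V i a) (V j b) \<le> r" for i a j b
  proof (rule ccontr)
    assume "f (V i a) \<noteq> f (V j b)"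
    then have "V i a \<subseteq> X \<and> V j b \<subseteq> Y \<or> V j b \<subseteq> X \<and> V i a \<subseteq> Y"
      using rng f1 that by metis
    then have "dplus \<Sigma> X Y \<le> dplus \<Sigma> (V i a) (V j b)"
      using dplus_antimono dplus_commute by metis
    with far that show False by (meson order.trans)
  qed
  have "potential (Phi \<Sigma> m V r) f"
    unfolding potential_def Phi_simps
  proof (intro conjI ballI allI impI)
    show "range f \<subseteq> {1, -1}" using rng by auto
    fix e x y assume e: "e \<in> {{V i 1, V i 2} | i. i \<in> {1..m}} \<times> {-1::int} \<union>
      (E' \<Sigma> m V r \<union> E'' \<Sigma> m V r) \<times> {1}" and xy: "fst e = {x, y}"
    from e show "snd e = f x * f y"
    proof
      assume "e \<in> {{V i 1, V i 2} | i. i \<in> {1..m}} \<times> {-1::int}"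
      then obtain i where i: "i \<in> {1..m}" "fst e = {V i 1, V i 2}" "snd e = -1" by auto
      with neg[of i] xy rng[of "V i 1"] show ?thesis by (auto simp: doubleton_eq_iff)
    next
      assume "e \<in> (E' \<Sigma> m V r \<union> E'' \<Sigma> m V r) \<times> {1}"
      then have e: "fst e \<in> E' \<Sigma> m V r \<union> E'' \<Sigma> m V r" "snd e = 1" by auto
      obtain i a j b where *: "fst e = {V i a, V j b}" "(i, a) \<in> ix" "(j, b) \<in> ix"
        "dplus \<Sigma> (V i a) (V j b) \<le> r \<or>
         dplus \<Sigma> (V i (transpose 1 2 a)) (V j (transpose 1 2 b)) \<le> r"
        using Phi_positive_edge[OF e(1)] by metis
      \<comment> \<open>If only the swapped pair is near, its values agree, and swapping labels
        negates both of them.\<close>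
      have "f (V i a) = f (V j b)"
        using *(4) near[OF *(2,3)] near[of i "transpose 1 2 a" j "transpose 1 2 b"]
          swap[OF *(2)] swap[OF *(3)] *(2,3) by (auto simp: ix_iff)
      with * xy e(2) rng[of "V i a"] show ?thesis by (auto simp: doubleton_eq_iff)
    qed
  qed
  then show ?thesis by (rule potential_imp_balanced)
qed

text \<open>Sides are collected by the value of a potential. Negative edges of \<open>Phi\<close>
  separate the two sides of every component, and positive ones keep near sides in the same
  class.\<close>

lemma balanced_imp_far_bipartition:
  assumes b: "balanced (Phi \<Sigma> m V (enat n))"
  obtains X Y where "{X, Y} \<in> stable_bipartitions H" "\<not> dplus \<Sigma> X Y \<le> enat n"
proof -
  obtain f where f: "potential (Phi \<Sigma> m V (enat n)) f"
    using balanced_imp_potential[OF signed_graph_Phi b] .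
  have rng: "f S = 1 \<or> f S = -1" for S using f by (auto simp: potential_def)
  have neg: "f (V i 1) * f (V i 2) = -1" if "i \<in> {1..m}" for i
  proof -
    have "({V i 1, V i 2}, -1) \<in> edges (Phi \<Sigma> m V (enat n))"
      using that unfolding Phi_simps by blast
    from potential_edge[OF f this] show ?thesis by (simp add: Phi_simps)
  qed
  have pos: "f (V i a) = f (V j b)"
    if "(i, a) \<in> ix" "(j, b) \<in> ix" "(i, a) \<noteq> (j, b)" "dplus \<Sigma> (V i a) (V j b) \<le> enat n" for i a j b
  proof -
    have "{V i a, V j b} \<in> E' \<Sigma> m V (enat n)" using that unfolding E'_def by blast
    then have "({V i a, V j b}, 1) \<in> edges (Phi \<Sigma> m V (enat n))"
      unfolding Phi_simps by blast
    from potential_edge[OF f this] have "f (V i a) * f (V j b) = 1" by (simp add: Phi_simps)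
    with rng[of "V i a"] show ?thesis by auto
  qed
  define X where "X = \<Union> {V i a | i a. (i, a) \<in> ix \<and> f (V i a) = 1}"
  define Y where "Y = \<Union> {V i a | i a. (i, a) \<in> ix \<and> f (V i a) = -1}"
  \<comment> \<open>Sides are pairwise disjoint, so a vertex determines the only side that could
    have brought it into \<open>X\<close>.\<close>
  have memX: "f (V i a) = 1" if "x \<in> X" "x \<in> V i a" "(i, a) \<in> ix" for x i a
    using that V_disjoint unfolding X_def by fastforce
  have memY: "f (V i a) = -1" if "x \<in> Y" "x \<in> V i a" "(i, a) \<in> ix" for x i a
    using that V_disjoint unfolding Y_def by fastforce
  have VH: "V i a \<subseteq> verts H" if "(i, a) \<in> ix" for i a
    using V_subset[OF that] component_eq(2)[of i] that by (auto simp: ix_iff)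
  have "X \<inter> Y = {}"
  proof -
    have False if x: "x \<in> X" "x \<in> Y" for x
    proof -
      obtain i a where "(i, a) \<in> ix" "x \<in> V i a" using x(1) unfolding X_def by blast
      with x memX memY show False by fastforce
    qed
    then show ?thesis by blast
  qed
  moreover have "X \<union> Y = verts H"
  proof
    show "X \<union> Y \<subseteq> verts H" using VH unfolding X_def Y_def by blast
    show "verts H \<subseteq> X \<union> Y"
    proof
      fix x assume "x \<in> verts H"
      then obtain i a where "(i, a) \<in> ix" "x \<in> V i a" using V_cover by blast
      with rng[of "V i a"] show "x \<in> X \<union> Y" unfolding X_def Y_def by blast
    qed
  qed
  moreover have "\<not> ends H e \<subseteq> X \<and> \<not> ends H e \<subseteq> Y" if e: "e \<in> edges H" for e
  proof -
    obtain x y where xy: "ends H e = {x, y}" "x \<in> verts H" using H_edge[OF e] by metis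
    obtain i where i: "i \<in> {1..m}" "x \<in> verts (C i)" using component_ex xy(2) by blast
    note ce = component_edge[OF i(1) e _ i(2)] and sb = stable_bipartitionD[OF V[OF i(1)]]
    have ix: "(i, 1) \<in> ix" "(i, 2) \<in> ix" using i by (auto simp: ix_iff)
    have "x \<in> V i 1 \<and> y \<in> V i 2 \<or> y \<in> V i 1 \<and> x \<in> V i 2"
      using ce xy sb(1) sb(3,4)[of e] by auto
    then obtain u v where uv: "{x, y} = {u, v}" "u \<in> V i 1" "v \<in> V i 2" by blast
    have "\<not> (u \<in> X \<and> v \<in> X)" using memX[OF _ uv(2) ix(1)] memX[OF _ uv(3) ix(2)] neg[OF i(1)] by auto
    moreover have "\<not> (u \<in> Y \<and> v \<in> Y)"
      using memY[OF _ uv(2) ix(1)] memY[OF _ uv(3) ix(2)] neg[OF i(1)] by auto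
    ultimately show ?thesis using xy(1) uv(1) by auto
  qed
  ultimately have XY: "{X, Y} \<in> stable_bipartitions H"
    by (intro stable_bipartitionI)
  moreover have "\<not> dplus \<Sigma> X Y \<le> enat n"
  proof
    assume "dplus \<Sigma> X Y \<le> enat n"
    then obtain i a j b where *: "(i, a) \<in> ix" "(j, b) \<in> ix" "(i, a) \<noteq> (j, b)" "V i a \<subseteq> X"
      "V j b \<subseteq> Y" "dplus \<Sigma> (V i a) (V j b) \<le> enat n"
      using bipartition_dplus_le[OF XY] by metis
    have "f (V i a) = 1" using memX V_nonempty * by blast
    moreover have "f (V j b) = -1" using memY V_nonempty * by blast
    ultimately show False using pos[OF *(1-3,6)] by simp
  qed
  ultimately show thesis by (rule that)
qed

end

section \<open>The maximal distance between the classes\<close>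

theorem theorem5p3:
  fixes \<Sigma> :: "('v, 'e) sgraph"
    and m l p :: nat
    and C :: "nat \<Rightarrow> ('v, 'e) sgraph"
    and V :: "nat \<Rightarrow> nat \<Rightarrow> 'v set"
    and w :: "nat \<Rightarrow> nat"
  assumes "signed_graph \<Sigma>"
    and "bipartite (neg_subgraph \<Sigma>)"
    and "bij_betw C {1..m} (components (neg_subgraph \<Sigma>))"
    and "\<And>i. i \<in> {1..m} \<Longrightarrow> {V i 1, V i 2} \<in> stable_bipartitions (C i)"
    and "strict_mono_on {1..l} w"
    and "(\<lambda>k. enat (w k)) ` {1..l} =
           {dplus \<Sigma> (V i \<alpha>) (V j \<beta>) | i \<alpha> j \<beta>.
              (i, \<alpha>) \<in> Phi_index m \<and> (j, \<beta>) \<in> Phi_index m \<and> (i, \<alpha>) \<noteq> (j, \<beta>)} - {\<infinity>}"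
    and "p \<in> {1..l}"
    and "\<not> balanced (Phi \<Sigma> m V (enat (w p)))"
    and "\<And>k. k \<in> {1..l} \<Longrightarrow> k < p \<Longrightarrow> balanced (Phi \<Sigma> m V (enat (w k)))"
  shows "Max {dplus \<Sigma> X Y | X Y. {X, Y} \<in> stable_bipartitions (neg_subgraph \<Sigma>)} = enat (w p)"
proof -
  interpret negative_components \<Sigma> m C V
    using assms(1,3,4) by unfold_locales
  have le: "dplus \<Sigma> X Y \<le> enat (w p)" if "{X, Y} \<in> stable_bipartitions H" for X Y
    using far_bipartition_imp_balanced[OF that] assms(8) by blast
  \<comment> \<open>The distance between the classes is finite by \<open>le\<close> and is realised
    by two differently indexed sides, so it is one of the listed values.\<close>
  have attained: "\<exists>k\<in>{1..l}. dplus \<Sigma> X Y = enat (w k)" if XY: "{X, Y} \<in> stable_bipartitions H" for X Y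
  proof -
    obtain n where n: "dplus \<Sigma> X Y = enat n"
      using le[OF XY] by (cases "dplus \<Sigma> X Y") auto
    then obtain i a j b where *: "(i, a) \<in> ix" "(j, b) \<in> ix" "(i, a) \<noteq> (j, b)" "V i a \<subseteq> X"
      "V j b \<subseteq> Y" "dplus \<Sigma> (V i a) (V j b) \<le> enat n"
      using bipartition_dplus_le[OF XY] by (metis order.refl)
    then have "dplus \<Sigma> (V i a) (V j b) = enat n"
      using dplus_antimono[OF *(4,5), of \<Sigma>] n by auto
    with * have "enat n \<in> (\<lambda>k. enat (w k)) ` {1..l}" unfolding assms(6) by force
    with n show ?thesis by auto
  qed
  \<comment> \<open>Minimality of \<open>p\<close> yields a bipartition beyond the preceding
    threshold. For \<open>p = 1\<close> there is none, and any stable bipartition serves.\<close>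
  obtain X Y where XY: "{X, Y} \<in> stable_bipartitions H"
    and far: "p \<noteq> 1 \<Longrightarrow> \<not> dplus \<Sigma> X Y \<le> enat (w (p - 1))"
  proof (cases "p = 1")
    case True
    obtain X Y where "{X, Y} \<in> stable_bipartitions H"
      using assms(2) unfolding bipartite_def stable_bipartitions_def by blast
    with that True show thesis by blast
  next
    case False
    then have "balanced (Phi \<Sigma> m V (enat (w (p - 1))))"
      using assms(7) by (intro assms(9)) auto
    with that show thesis by (metis balanced_imp_far_bipartition)
  qed
  obtain k where k: "k \<in> {1..l}" "dplus \<Sigma> X Y = enat (w k)" using attained[OF XY] by blast
  have "k \<le> p"
    using le[OF XY] k assms(5,7) by (metis enat_ord_simps(1) leD leI strict_mono_onD)
  moreover have "p - 1 < k" if "p \<noteq> 1"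
  proof (rule ccontr)
    assume "\<not> ?thesis"
    then have "w k \<le> w (p - 1)"
      using assms(5,7) k that
      by (intro mono_onD[OF strict_mono_on_imp_mono_on[OF assms(5)]]) auto
    with far[OF that] k show False by simp
  qed
  \<comment> \<open>When \<open>p = 1\<close>, the lower bound comes from \<open>k\<close> being at
    least 1.\<close>
  ultimately have "k = p" using k(1) by fastforce
  with k XY have "enat (w p) \<in> {dplus \<Sigma> X Y | X Y. {X, Y} \<in> stable_bipartitions H}" by force
  \<comment> \<open>\<open>Max\<close> is meaningful only on finite sets; a finite bound in
    \<open>enat\<close> leaves finitely many values.\<close>
  moreover have "finite {dplus \<Sigma> X Y | X Y. {X, Y} \<in> stable_bipartitions H}"
    by (rule finite_enat_bounded[of _ "w p"]) (use le in auto)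
  ultimately show ?thesis using le by (intro Max_eqI) auto
qed

end
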